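(* Let $p\in(-\infty,-1]\cup[0,\infty)$. The two-sided inequality $$x\,\frac{(3p+1)+2\sqrt{1-x^2}}{2p+(p+3)\sqrt{1-x^2}}<\arcsin x<\frac{\pi p}{3p+1}\,x\,\frac{(3p+1)+2\sqrt{1-x^2}}{2p+(p+3)\sqrt{1-x^2}}$$ holds for all $x\in(0,1)$ if and only if $p\in(-\infty,-1]\cup[9,\infty)$, where the constant $\frac{\pi p}{3p+1}$ is the best possible. Moreover, for each $x\in(0,1)$, the lower and upper bounds in this two-sided inequality are, respectively, decreasing and increasing in $p$ on each of the intervals $(-\infty,-1]$ and $(0,\infty)$. The two-sided inequality is reversed (both inequality signs reversed, for all $x\in(0,1)$) if $p\in[0,p_1]$, where $$p_1=\frac{2\sqrt{6\pi+1}+3\pi-2}{12-3\pi}\approx 6.343.$$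
   Context: "Best possible" means that, for $p\in(-\infty,-1]\cup[9,\infty)$, the constant $\frac{\pi p}{3p+1}$ in the upper bound cannot be replaced by a smaller one (with the inequality still valid for all $x\in(0,1)$). *)

theory Defs
  imports Complex_Main
begin

text \<open>
  For \<open>0 < x < 1\<close> no division by zero occurs on the parameter domain: the denominator
  \<open>2 p + (p + 3) sqrt (1 - x^2)\<close> is positive for \<open>p \<ge> 0\<close> and negative
  (as is \<open>3 p + 1 + 2 sqrt (1 - x^2)\<close>) for \<open>p \<le> -1\<close>, and \<open>3 p + 1 \<noteq> 0\<close>.
\<close>

definition arcsin_lower :: "real \<Rightarrow> real \<Rightarrow> real" where
  "arcsin_lower p x =
     x * (((3 * p + 1) + 2 * sqrt (1 - x\<^sup>2)) / (2 * p + (p + 3) * sqrt (1 - x\<^sup>2)))"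

definition upper_const :: "real \<Rightarrow> real" where
  "upper_const p = pi * p / (3 * p + 1)"

definition arcsin_upper :: "real \<Rightarrow> real \<Rightarrow> real" where
  "arcsin_upper p x = upper_const p * arcsin_lower p x"

definition p1 :: real where
  "p1 = (2 * sqrt (6 * pi + 1) + 3 * pi - 2) / (12 - 3 * pi)"

end

theory Submission
  imports Defs "HOL-Analysis.Complex_Transcendental"
begin

text \<open>
  Substitute \<open>x = sin t\<close> with \<open>0 < t < \<pi>/2\<close>. The bounds become \<open>L(t)\<close> and \<open>K L(t)\<close>, where
  \<open>L(t) = sin t (3p + 1 + 2 cos t) / (2p + (p + 3) cos t)\<close> and \<open>K = \<pi>p/(3p + 1)\<close>, to be
  compared with \<open>t\<close>. Write \<open>c = cos t\<close> and \<open>M = 2p + (p + 3) c\<close>.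

  \<^bold>\<open>Lower bound.\<close> The numerator of \<open>1 - L'\<close> is a cubic in \<open>c\<close> with a double root at \<open>c = 1\<close>:
  \<open>1 - L' = (1 - c)\<^sup>2 (p\<^sup>2 - 6p - 3 - 2(p + 3) c) / M\<^sup>2\<close>
  (\<open>has_field_derivative_trig_bound\<close>). At \<open>c = 1\<close> the linear factor equals \<open>(p - 9)(p + 1)\<close>,
  which explains the thresholds \<open>-1\<close> and \<open>9\<close>: outside \<open>(-1, 9)\<close> the factor is positive on
  \<open>(0, 1)\<close>, whereas for \<open>0 \<le> p < 9\<close> it is negative near \<open>c = 1\<close>, so the inequality already
  fails for small \<open>t\<close>. For \<open>0 \<le> p \<le> p1\<close> it decreases in \<open>c\<close> and its value \<open>p\<^sup>2 - 6p - 3\<close> at \<open>c = 0\<close>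
  is already negative, which gives the reversed bound there.

  \<^bold>\<open>Upper bound.\<close> The constant \<open>K\<close> makes \<open>g(t) = t - K L(t)\<close> vanish at both \<open>0\<close> and
  \<open>\<pi>/2\<close>, so \<open>g\<close> has a constant sign in between as soon as \<open>g'\<close> changes sign at most once, in
  the right direction (\<open>pos_between_zeros_if_derivative_crosses_once\<close>). The numerator of \<open>g'\<close> is
  again a cubic in \<open>c\<close>. In the Bernstein basis \<open>(1 - c)\<^sup>3, (1 - c)\<^sup>2 c, (1 - c) c\<^sup>2, c\<^sup>3\<close> its last two
  coefficients are nonnegative multiples of \<open>1 - K\<close>, so whatever the second one is, there is at
  most one sign change if the first coefficient has the sign opposite to that of \<open>1 - K\<close>
  (\<open>bernstein_cubic_one_sign_change\<close>, \<open>upper_comparison\<close>). That first coefficient is the slope of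
  \<open>g\<close> at \<open>\<pi>/2\<close> up to a positive factor, and its sign is that of a quadratic in \<open>p\<close> whose positive
  root is \<open>p1\<close>: this is where \<open>p1\<close> comes from.

  Optimality of \<open>K\<close> is the limit \<open>t \<rightarrow> \<pi>/2\<close>, and monotonicity in \<open>p\<close> is a comparison of two
  fractions by cross-multiplication.
\<close>

section \<open>The bound as a function of the angle\<close>

definition trig_bound :: "real \<Rightarrow> real \<Rightarrow> real" where
  "trig_bound p t = sin t * ((3 * p + 1 + 2 * cos t) / (2 * p + (p + 3) * cos t))"

text \<open>
  For \<open>p > 0\<close> or \<open>p \<le> -1\<close> this has the sign of the derivative of
  \<open>t - upper_const p * trig_bound p t\<close> at \<open>t = \<pi>/2\<close>.
\<close>
definition endpoint_quadratic :: "real \<Rightarrow> real" where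
  "endpoint_quadratic p = (12 - 3 * pi) * p\<^sup>2 + (4 - 6 * pi) * p - 3 * pi"

lemma denominator_pos:
  fixes p c :: real
  assumes "0 < p \<and> 0 \<le> c \<or> 0 \<le> p \<and> 0 < c"
  shows "0 < 2 * p + (p + 3) * c"
proof -
  have "0 \<le> (p + 3) * c" "0 < c \<Longrightarrow> 0 < (p + 3) * c"
    using assms by (auto intro!: mult_nonneg_nonneg mult_pos_pos)
  then show ?thesis using assms by linarith
qed

lemma denominator_neg:
  fixes p c :: real
  assumes "p \<le> - 1" "0 \<le> c" "c < 1"
  shows "2 * p + (p + 3) * c < 0"
proof -
  have "(p + 1) * (2 + c) \<le> 0" using assms by (intro mult_nonpos_nonneg) auto
  then show ?thesis using assms by (simp add: algebra_simps)
qed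

lemma denominator_nonzero:
  fixes p c :: real
  assumes "p \<le> - 1 \<or> 0 \<le> p" "0 < c" "c < 1"
  shows "2 * p + (p + 3) * c \<noteq> 0"
  using denominator_pos[of p c] denominator_neg[of p c] assms by fastforce

lemma cos_open_unit:
  assumes "0 < t" "t < pi / 2"
  shows "0 < cos t" "cos t < 1"
  using cos_gt_zero[OF assms] cos_monotone_0_pi[of 0 t] assms by auto

text \<open>
  For \<open>p \<noteq> -1\<close>, near \<open>t = 0\<close>, the quotient in \<open>trig_bound\<close> agrees with \<open>t / sin t\<close> to second order; this is why
  \<open>(1 - cos t)\<^sup>2\<close> splits off, leaving only a linear factor to be discussed.
\<close>
lemma has_field_derivative_trig_bound:
  assumes "2 * p + (p + 3) * cos t \<noteq> 0"
  shows "(trig_bound p has_real_derivative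
    1 - (1 - cos t)\<^sup>2 * (p\<^sup>2 - 6 * p - 3 - 2 * (p + 3) * cos t)
        / (2 * p + (p + 3) * cos t)\<^sup>2) (at t)"
proof -
  let ?M = "2 * p + (p + 3) * cos t"
  let ?n = "(cos t * (3 * p + 1 + 2 * cos t) - 2 * (sin t)\<^sup>2) * ?M
    + (p + 3) * (sin t)\<^sup>2 * (3 * p + 1 + 2 * cos t)"
  have "(trig_bound p has_real_derivative ?n / ?M\<^sup>2) (at t)"
    unfolding trig_bound_def [abs_def] using assms
    by (auto intro!: derivative_eq_intros simp: divide_simps)
      (simp add: algebra_simps power2_eq_square)
  moreover have "?n = ?M\<^sup>2 - (1 - cos t)\<^sup>2 * (p\<^sup>2 - 6 * p - 3 - 2 * (p + 3) * cos t)"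
    unfolding sin_squared_eq by (simp add: algebra_simps power2_eq_square)
  ultimately show ?thesis using assms by (simp add: diff_divide_distrib)
qed

text \<open>
  At \<open>p = -1\<close> numerator and denominator are both \<open>2 cos t - 2\<close>, so the quotient degenerates
  to \<open>0/0\<close> at \<open>t = 0\<close>; the outer factor \<open>sin t\<close> makes the formula correct there as well.
\<close>
lemma trig_bound_minus_one:
  assumes "0 \<le> t" "t \<le> pi / 2"
  shows "trig_bound (- 1) t = sin t"
proof (cases "t = 0")
  case False
  then have "cos t < 1" using cos_monotone_0_pi[of 0 t] assms by auto
  then show ?thesis by (simp add: trig_bound_def divide_simps)
qed (simp add: trig_bound_def)

lemma continuous_on_trig_bound:
  assumes "p \<le> - 1 \<or> 0 < p"
  shows "continuous_on {0..pi / 2} (trig_bound p)"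
proof (cases "p = - 1")
  case True
  have "continuous_on {0..pi / 2} (\<lambda>t::real. sin t)" by (intro continuous_intros)
  then show ?thesis
    unfolding True by (rule continuous_on_eq) (simp add: trig_bound_minus_one)
next
  case False
  have "2 * p + (p + 3) * cos t \<noteq> 0" if "t \<in> {0..pi / 2}" for t
  proof -
    have c: "0 \<le> cos t" "cos t \<le> 1" using that by (auto intro: cos_ge_zero)
    show ?thesis
    proof (cases "0 < p")
      case True
      then show ?thesis using denominator_pos[of p "cos t"] c by auto
    next
      case False
      then have "(p + 1) * (2 + cos t) < 0"
        using assms \<open>p \<noteq> - 1\<close> c by (intro mult_neg_pos) auto
      moreover have "2 * p + (p + 3) * cos t = (p + 1) * (2 + cos t) - 2 * (1 - cos t)"
        by (simp add: algebra_simps)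
      moreover have "(p + 1) * (2 + cos t) - 2 * (1 - cos t) \<le> (p + 1) * (2 + cos t)"
        using c(2) by simp
      ultimately show ?thesis by (metis less_irrefl order.strict_trans1)
    qed
  qed
  then show ?thesis unfolding trig_bound_def [abs_def] by (intro continuous_intros) auto
qed

section \<open>Comparison principles\<close>

text \<open>
  The sign \<open>\<sigma> = 1\<close> or \<open>\<sigma> = -1\<close> treats the bound and its reversal alike. The sign
  condition is imposed only before \<open>t\<close>, so that the failure of the lower bound for small \<open>t\<close> is
  covered too.
\<close>
lemma lower_comparison:
  assumes p: "p \<le> - 1 \<or> 0 \<le> p" and t: "0 < t" "t < pi / 2"
    and s: "\<And>s. 0 < s \<Longrightarrow> s < t \<Longrightarrow>
      0 < \<sigma> * (p\<^sup>2 - 6 * p - 3 - 2 * (p + 3) * cos s)"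
  shows "0 < \<sigma> * (t - trig_bound p t)"
proof -
  let ?g = "\<lambda>s. \<sigma> * (s - trig_bound p s)"
  have "continuous_on {0..t} (trig_bound p)"
  proof (cases "p = 0")
    case True
    have "cos s > 0" if "s \<in> {0..t}" for s
      using that t by (intro cos_gt_zero_pi) auto
    then show ?thesis unfolding trig_bound_def [abs_def] True
      by (intro continuous_intros) (auto simp: less_imp_neq[symmetric])
  next
    case False
    then show ?thesis using p t
      by (intro continuous_on_subset[OF continuous_on_trig_bound]) auto
  qed
  then have cont: "continuous_on {0..t} ?g" by (intro continuous_intros)
  have deriv: "\<exists>y. (?g has_real_derivative y) (at s) \<and> 0 < y" if "0 < s" "s < t" for s
  proof -
    have c: "0 < cos s" "cos s < 1" using cos_open_unit that t by auto
    note M = denominator_nonzero[OF p c]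
    let ?y = "(p\<^sup>2 - 6 * p - 3 - 2 * (p + 3) * cos s)"
    let ?M = "(2 * p + (p + 3) * cos s)"
    have "(?g has_real_derivative \<sigma> * ((1 - cos s)\<^sup>2 * ?y / ?M\<^sup>2)) (at s)"
      by (rule derivative_eq_intros has_field_derivative_trig_bound M refl)+ simp
    moreover from mult_pos_pos[OF _ s[OF that], of "(1 - cos s)\<^sup>2 / ?M\<^sup>2"]
    have "0 < \<sigma> * ((1 - cos s)\<^sup>2 * ?y / ?M\<^sup>2)"
      using c M by (simp add: mult.left_commute)
    ultimately show ?thesis by blast
  qed
  have "?g 0 < ?g t"
    by (rule DERIV_pos_imp_increasing_open[OF t(1) deriv cont])
  then show ?thesis by (simp add: trig_bound_def)
qed

text \<open>
  Were \<open>g t \<le> 0\<close>, the mean value theorem would give a nonpositive slope before \<open>t\<close> and a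
  nonnegative one after it, which the crossing condition forbids.
\<close>
lemma pos_between_zeros_if_derivative_crosses_once:
  fixes g g' :: "real \<Rightarrow> real"
  assumes cont: "continuous_on {a..b} g" and zeros: "g a = 0" "g b = 0"
    and deriv: "\<And>s. a < s \<Longrightarrow> s < b \<Longrightarrow> (g has_real_derivative g' s) (at s)"
    and cross: "\<And>r s. a < r \<Longrightarrow> r < s \<Longrightarrow> s < b \<Longrightarrow> g' r \<le> 0 \<Longrightarrow> g' s < 0"
    and t: "a < t" "t < b"
  shows "0 < g t"
proof (rule ccontr)
  assume neg: "\<not> 0 < g t"
  have diff: "g differentiable at s" if "a < s" "s < b" for s
    using deriv[OF that] real_differentiable_def by blast
  obtain l r where r: "a < r" "r < t" "DERIV g r :> l" "g t - g a = (t - a) * l"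
    using MVT[of a t g] t diff continuous_on_subset[OF cont] by force
  obtain m s where s: "t < s" "s < b" "DERIV g s :> m" "g b - g t = (b - t) * m"
    using MVT[of t b g] t diff continuous_on_subset[OF cont] by force
  have "l = g' r" "m = g' s" using DERIV_unique deriv r s t by (metis less_trans)+
  moreover have "l \<le> 0" using r neg t zeros by (auto simp: not_less mult_le_0_iff)
  moreover have "0 \<le> (b - t) * m" using s neg zeros by simp
  then have "0 \<le> m" using t by (simp add: zero_le_mult_iff)
  ultimately show False using cross[of r s] r s t by auto
qed

text \<open>
  An instance of Descartes' rule of signs: after division by \<open>u\<close>, the polynomial becomes
  \<open>a0/u + a1 + a2 u + a3 u\<^sup>2\<close>, which increases strictly on the positive axis.
\<close>
lemma cubic_one_sign_change:
  fixes a0 a1 a2 a3 u w :: real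
  assumes a: "a0 \<le> 0" "0 \<le> a2" "0 \<le> a3" "a0 < 0 \<or> 0 < a2"
    and u: "0 < u" "u < w" and nonneg: "0 \<le> a0 + a1 * u + a2 * u\<^sup>2 + a3 * u ^ 3"
  shows "0 < a0 + a1 * w + a2 * w\<^sup>2 + a3 * w ^ 3"
proof -
  have sq: "u\<^sup>2 < w\<^sup>2" using u by (intro power_strict_mono) auto
  have "0 \<le> - a0 * (w - u)" "0 \<le> a2 * (u * w * (w - u))" "0 \<le> a3 * (u * w * (w\<^sup>2 - u\<^sup>2))"
    using a u sq by (auto intro!: mult_nonneg_nonneg mult_nonpos_nonneg)
  moreover have "a0 < 0 \<Longrightarrow> 0 < - a0 * (w - u)" "0 < a2 \<Longrightarrow> 0 < a2 * (u * w * (w - u))"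
    using u by (auto intro!: mult_pos_pos mult_neg_pos)
  ultimately have
    "0 < - a0 * (w - u) + a2 * (u * w * (w - u)) + a3 * (u * w * (w\<^sup>2 - u\<^sup>2))"
    using a(4) by linarith
  also have "\<dots> = u * (a0 + a1 * w + a2 * w\<^sup>2 + a3 * w ^ 3)
      - w * (a0 + a1 * u + a2 * u\<^sup>2 + a3 * u ^ 3)"
    by (simp add: algebra_simps power2_eq_square power3_eq_cube)
  finally have "0 < u * (a0 + a1 * w + a2 * w\<^sup>2 + a3 * w ^ 3)"
    using mult_nonneg_nonneg[OF _ nonneg, of w] u by linarith
  then show ?thesis using u by (simp add: zero_less_mult_iff)
qed

text \<open>
  Division by \<open>(1 - c)\<^sup>3\<close> turns the Bernstein form into the previous cubic in
  \<open>u = c / (1 - c)\<close>, an increasing function of \<open>c\<close>.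
\<close>
lemma bernstein_cubic_one_sign_change:
  fixes a0 a1 a2 a3 c d :: real
  assumes a: "a0 \<le> 0" "0 \<le> a2" "0 \<le> a3" "a0 < 0 \<or> 0 < a2"
    and c: "0 < c" "c < d" "d < 1"
    and nonneg: "0 \<le> a0 * (1 - c) ^ 3 + a1 * (1 - c)\<^sup>2 * c + a2 * (1 - c) * c\<^sup>2 + a3 * c ^ 3"
  shows "0 < a0 * (1 - d) ^ 3 + a1 * (1 - d)\<^sup>2 * d + a2 * (1 - d) * d\<^sup>2 + a3 * d ^ 3"
proof -
  let ?q = "\<lambda>u. a0 + a1 * u + a2 * u\<^sup>2 + a3 * u ^ 3"
  have eq: "a0 * (1 - z) ^ 3 + a1 * (1 - z)\<^sup>2 * z + a2 * (1 - z) * z\<^sup>2 + a3 * z ^ 3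
      = (1 - z) ^ 3 * ?q (z / (1 - z))" if "z < 1" for z
  proof -
    define v where "v = 1 - z"
    then have "v \<noteq> 0" using that by simp
    then show ?thesis unfolding v_def [symmetric]
      by (simp add: field_simps power2_eq_square power3_eq_cube)
  qed
  have "0 \<le> (1 - c) ^ 3 * ?q (c / (1 - c))"
    using nonneg eq[of c] c by simp
  then have "0 \<le> ?q (c / (1 - c))"
    using c zero_less_power[of "1 - c" 3] by (simp only: zero_le_mult_iff) linarith
  moreover have "c / (1 - c) < d / (1 - d)"
    using c by (simp add: divide_simps algebra_simps)
  ultimately have "0 < ?q (d / (1 - d))"
    using cubic_one_sign_change[OF a, of "c / (1 - c)" "d / (1 - d)" a1] c by simp
  then have "0 < (1 - d) ^ 3 * ?q (d / (1 - d))"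
    using c by (intro mult_pos_pos) auto
  then show ?thesis using eq[of d] c by simp
qed

text \<open>
  The first hypothesis on \<open>\<sigma>\<close> fixes the last two Bernstein coefficients, the second one the
  first coefficient. At \<open>p = -1\<close> the last two vanish, hence strictness must
  then come from the first one.
\<close>
lemma upper_comparison:
  assumes p: "p \<le> - 1 \<or> 0 < p" and t: "0 < t" "t < pi / 2"
    and K: "0 < \<sigma> * (1 - upper_const p)"
    and Q: "\<sigma> * endpoint_quadratic p \<le> 0" "p \<le> - 1 \<Longrightarrow> endpoint_quadratic p \<noteq> 0"
  shows "0 < \<sigma> * (t - upper_const p * trig_bound p t)"
proof -
  define K where "K = upper_const p"
  let ?E = "p\<^sup>2 - 6 * p - 3"
  let ?M = "\<lambda>c. 2 * p + (p + 3) * c"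
  let ?P = "\<lambda>c. (1 - K) * (?M c)\<^sup>2 + K * ((1 - c)\<^sup>2 * (?E - 2 * (p + 3) * c))"
  let ?g = "\<lambda>s. \<sigma> * (s - K * trig_bound p s)"
  let ?g' = "\<lambda>s. \<sigma> * ?P (cos s) / (?M (cos s))\<^sup>2"
  \<comment> \<open>The Bernstein coefficients of \<open>?P\<close>, found with \<open>?M c = 2p (1 - c) + 3 (p + 1) c\<close>.\<close>
  define a0 where "a0 = (1 - K) * (2 * p)\<^sup>2 + K * ?E"
  define a1 where "a1 = (1 - K) * ((2 * p)\<^sup>2 + 12 * p * (p + 1)) + K * (?E - 2 * (p + 3))"
  define a2 where "a2 = (1 - K) * (3 * (p + 1) * (7 * p + 3))"
  define a3 where "a3 = (1 - K) * (9 * (p + 1)\<^sup>2)"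
  have P: "\<sigma> * ?P c = \<sigma> * a0 * (1 - c) ^ 3 + \<sigma> * a1 * (1 - c)\<^sup>2 * c
      + \<sigma> * a2 * (1 - c) * c\<^sup>2 + \<sigma> * a3 * c ^ 3" for c
    unfolding a0_def a1_def a2_def a3_def
    by (simp add: algebra_simps power2_eq_square power3_eq_cube)
  have r: "0 < p / (3 * p + 1)" using p by (auto simp: zero_less_divide_iff)
  have nz: "3 * p + 1 \<noteq> 0" using p by auto
  then have KA: "K * (3 * p + 1) = pi * p" by (simp add: K_def upper_const_def)
  have "a0 * (3 * p + 1) = (3 * p + 1) * (2 * p)\<^sup>2 + (K * (3 * p + 1)) * (?E - (2 * p)\<^sup>2)"
    by (simp add: a0_def algebra_simps)
  also have "\<dots> = p * endpoint_quadratic p"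
    unfolding KA endpoint_quadratic_def by (simp add: algebra_simps power2_eq_square)
  finally have a0: "a0 = p / (3 * p + 1) * endpoint_quadratic p"
    using nz by (simp add: eq_divide_eq)
  have s0: "\<sigma> \<noteq> 0" using K by auto
  have A0: "\<sigma> * a0 \<le> 0" "p \<le> - 1 \<Longrightarrow> \<sigma> * a0 < 0"
    using mult_nonneg_nonpos[OF less_imp_le[OF r] Q(1)] Q(2) r s0
    unfolding a0 by (auto simp: mult.left_commute less_le)
  have "0 \<le> 3 * (p + 1) * (7 * p + 3)"
    using p by (auto simp: zero_le_mult_iff)
  then have A2: "0 \<le> \<sigma> * a2" "0 \<le> \<sigma> * a3"
    using mult_nonneg_nonneg[OF less_imp_le[OF K]]
      mult_nonneg_nonneg[OF less_imp_le[OF K], of "9 * (p + 1)\<^sup>2"]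
    unfolding a2_def a3_def K_def by (simp_all only: mult.assoc) simp
  have "0 < 3 * (p + 1) * (7 * p + 3)" if "0 < p"
    using that by (intro mult_pos_pos) auto
  then have "0 < \<sigma> * a2" if "0 < p"
    using mult_pos_pos[OF K] that unfolding a2_def K_def by (metis mult.assoc)
  then have A3: "\<sigma> * a0 < 0 \<or> 0 < \<sigma> * a2" using A0 p by auto
  have M: "?M (cos s) \<noteq> 0" if "0 < s" "s < pi / 2" for s
    using denominator_nonzero[of p "cos s"] cos_open_unit[OF that] p by auto
  show ?thesis unfolding K_def [symmetric]
  proof (rule pos_between_zeros_if_derivative_crosses_once[where g = ?g and g' = ?g', OF _ _ _ _ _ t])
    show "continuous_on {0..pi / 2} ?g"
      using continuous_on_trig_bound[OF p] by (intro continuous_intros)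
    show "?g 0 = 0" by (simp add: trig_bound_def)
    show "?g (pi / 2) = 0"
      using p by (auto simp: trig_bound_def K_def upper_const_def divide_simps)
    show "(?g has_real_derivative ?g' s) (at s)" if "0 < s" "s < pi / 2" for s
      by (rule derivative_eq_intros has_field_derivative_trig_bound M[OF that] refl)+
        (use M[OF that] in \<open>simp add: field_simps\<close>)
    show "?g' s < 0" if rs: "0 < r" "r < s" "s < pi / 2" "?g' r \<le> 0" for r s
    proof (rule ccontr)
      assume "\<not> ?g' s < 0"
      then have "0 \<le> \<sigma> * ?P (cos s)" using M[of s] rs by (simp add: zero_le_divide_iff not_less)
      moreover have "0 < cos s" "cos s < cos r" "cos r < 1"
        using rs cos_open_unit[of s] cos_open_unit[of r] cos_monotone_0_pi[of r s] by auto
      ultimately have "0 < \<sigma> * ?P (cos r)"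
        unfolding P by (intro bernstein_cubic_one_sign_change[OF A0(1) A2 A3])
      then have "0 < ?g' r" using M[of r] rs by (intro divide_pos_pos) auto
      then show False using rs by simp
    qed
  qed
qed

section \<open>Returning to the arcsine\<close>

lemma arcsin_lower_sin:
  assumes "0 < t" "t < pi / 2"
  shows "arcsin_lower p (sin t) = trig_bound p t"
proof -
  have "sqrt (1 - (sin t)\<^sup>2) = cos t"
    using cos_open_unit[OF assms] by (simp add: cos_squared_eq[symmetric])
  then show ?thesis by (simp add: arcsin_lower_def trig_bound_def)
qed

lemma ball_arcsin_iff:
  "(\<forall>x\<in>{0<..<1}. R (arcsin_lower p x) (arcsin x)) \<longleftrightarrow>
   (\<forall>t\<in>{0<..<pi / 2}. R (trig_bound p t) t)"
proof safe
  fix t assume *: "\<forall>x\<in>{0<..<1}. R (arcsin_lower p x) (arcsin x)" and t: "t \<in> {0<..<pi / 2}"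
  have "sin t \<in> {0<..<1}"
    using t sin_gt_zero[of t] sin_monotone_2pi[of t "pi / 2"] by auto
  with * have "R (arcsin_lower p (sin t)) (arcsin (sin t))" by blast
  then show "R (trig_bound p t) t" using t arcsin_lower_sin arcsin_sin by auto
next
  fix x :: real assume *: "\<forall>t\<in>{0<..<pi / 2}. R (trig_bound p t) t" and x: "x \<in> {0<..<1}"
  then have "0 < arcsin x" "arcsin x < pi / 2"
    using arcsin_less_arcsin[of 0 x] arcsin_lt_bounded[of x] by auto
  then show "R (arcsin_lower p x) (arcsin x)"
    using * x arcsin_lower_sin[of "arcsin x" p] by auto
qed

section \<open>The two-sided bound\<close>

text \<open>
  The factor \<open>p\<^sup>2 - 6p - 3 - 2(p + 3) c\<close> is linear in \<open>c\<close>, so it suffices to look at its values at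
  \<open>c = 0\<close> and \<open>c = 1\<close>.
\<close>
lemma lower_bound:
  assumes p: "p \<le> - 1 \<or> 9 \<le> p" and t: "0 < t" "t < pi / 2"
  shows "trig_bound p t < t"
proof -
  have "0 < 1 * (p\<^sup>2 - 6 * p - 3 - 2 * (p + 3) * cos s)" if "0 < s" "s < t" for s
  proof -
    have c: "0 < cos s" "cos s < 1" using cos_open_unit that t by auto
    have "p\<^sup>2 - 6 * p - 3 - 2 * (p + 3) * cos s
        = (1 - cos s) * (p\<^sup>2 - 6 * p - 3) + cos s * ((p - 9) * (p + 1))"
      by (simp add: algebra_simps power2_eq_square)
    moreover have "0 \<le> (p - 9) * (p + 1)"
      using p by (auto intro: mult_nonneg_nonneg mult_nonpos_nonpos)
    moreover have "0 < p\<^sup>2 - 6 * p - 3"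
    proof (cases "p \<le> - 1")
      case True
      then show ?thesis using zero_le_power2[of p] by linarith
    next
      case False
      then have "9 \<le> p" using p by auto
      moreover from this have "9 * p \<le> p * p" by (intro mult_right_mono) auto
      ultimately show ?thesis unfolding power2_eq_square by linarith
    qed
    ultimately show ?thesis using c by (simp add: add_pos_nonneg)
  qed
  from lower_comparison[OF _ t this] show ?thesis using p by auto
qed

text \<open>
  The linear factor is negative at \<open>c = 1\<close>, hence also for all \<open>c\<close> beyond its root, that is, for
  all small enough angles. The maximum with \<open>1/2\<close> merely keeps the angle below \<open>\<pi>/2\<close>.
\<close>
lemma lower_bound_fails:
  assumes p: "0 \<le> p" "p < 9"
  obtains t where "0 < t" "t < pi / 2" "t < trig_bound p t"
proof -
  define c where "c = max (1 / 2) ((p\<^sup>2 - 6 * p - 3) / (2 * (p + 3)))"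
  have "(p - 9) * (p + 1) < 0" using p by (intro mult_neg_pos) auto
  then have c: "0 < c" "c < 1"
    using p by (auto simp: c_def divide_simps algebra_simps power2_eq_square)
  have "(p\<^sup>2 - 6 * p - 3) / (2 * (p + 3)) \<le> c" by (simp add: c_def)
  then have cle: "p\<^sup>2 - 6 * p - 3 \<le> 2 * (p + 3) * c"
    using p by (simp add: pos_divide_le_eq mult.commute)
  define t where "t = arccos c"
  have t: "0 < t" "t < pi / 2"
    using c arccos_less_arccos[of c 1] arccos_less_arccos[of 0 c] by (auto simp: t_def)
  have "0 < (- 1) * (p\<^sup>2 - 6 * p - 3 - 2 * (p + 3) * cos s)" if "0 < s" "s < t" for s
  proof -
    have "c < cos s" using cos_monotone_0_pi[of s t] that t c by (simp add: t_def)
    then have "2 * (p + 3) * c < 2 * (p + 3) * cos s" using p by simp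
    then show ?thesis using cle by simp
  qed
  from lower_comparison[OF _ t this] have "t < trig_bound p t" using p by auto
  with t that show ?thesis by blast
qed

lemma pi_bounds: "3.1415 < pi" "pi < 3.1416"
  using pi_approx by simp_all

text \<open>
  Here the upper comparison runs with \<open>\<sigma> = -1\<close>. The condition \<open>upper_const p > 1\<close> amounts to
  \<open>(\<pi> - 3) p > 1\<close> for positive \<open>p\<close> and to \<open>(\<pi> - 3) p < 1\<close> for \<open>p \<le> -1\<close>.
\<close>
lemma upper_bound:
  assumes p: "p \<le> - 1 \<or> 9 \<le> p" and t: "0 < t" "t < pi / 2"
  shows "t < upper_const p * trig_bound p t"
proof -
  have "(pi - 3) * p < 1 \<or> 9 \<le> p" "9 \<le> p \<Longrightarrow> 1 < (pi - 3) * p"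
    using p pi_bounds mult_mono[of "0.14" "pi - 3" 9 p] mult_nonneg_nonpos[of "pi - 3" p]
    by auto
  then have K: "0 < (- 1) * (1 - upper_const p)"
    using p by (auto simp: upper_const_def divide_simps algebra_simps)
  have Q: "0 < endpoint_quadratic p"
  proof (cases "9 \<le> p")
    case True
    have "0 \<le> (12 - 3 * pi) * (p * (p - 9))" "0 \<le> (112 - 33 * pi) * (p - 9)"
      using True pi_bounds by (auto intro!: mult_nonneg_nonneg)
    then show ?thesis using pi_bounds
      by (simp add: endpoint_quadratic_def algebra_simps power2_eq_square)
  next
    case False
    then have "p \<le> - 1" using p by auto
    then have "0 \<le> (12 - 3 * pi) * (p * (p + 1))" "0 \<le> (6 * pi - 4 + 12 - 3 * pi) * (- 1 - p)"
      using pi_bounds by (intro mult_nonneg_nonneg mult_nonpos_nonpos; simp)+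
    then show ?thesis using pi_bounds
      by (simp add: endpoint_quadratic_def algebra_simps power2_eq_square)
  qed
  have "0 < (- 1) * (t - upper_const p * trig_bound p t)"
    by (rule upper_comparison) (use p t K Q in auto)
  then show ?thesis by simp
qed

section \<open>The threshold of the reversed bound\<close>

lemma p1_bounds: "6.3425 < p1" "p1 < 6.3435"
proof -
  define r where "r = sqrt (6 * pi + 1)"
  have "4.4552 < r"
    unfolding r_def by (rule real_less_rsqrt) (use pi_bounds in \<open>simp add: power2_eq_square\<close>)
  moreover have "r < 4.4554"
    unfolding r_def by (rule real_less_lsqrt) (use pi_bounds in \<open>simp_all add: power2_eq_square\<close>)
  ultimately have "6.3425 * (12 - 3 * pi) < 2 * r + 3 * pi - 2" "2 * r + 3 * pi - 2 < 6.3435 * (12 - 3 * pi)"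
    using pi_bounds pi_approx by auto
  then show "6.3425 < p1" "p1 < 6.3435"
    unfolding p1_def r_def [symmetric] using pi_bounds
    by (simp_all add: pos_less_divide_eq pos_divide_less_eq)
qed

lemma endpoint_quadratic_p1: "endpoint_quadratic p1 = 0"
proof -
  define r where "r = sqrt (6 * pi + 1)"
  have r: "r * r = 6 * pi + 1" using pi_bounds by (simp add: r_def)
  define m where "m = 12 - 3 * pi"
  have m: "m \<noteq> 0" using pi_bounds by (simp add: m_def)
  have p1: "m * p1 = 2 * r + 3 * pi - 2"
    using m by (simp add: p1_def r_def m_def)
  have "m * endpoint_quadratic p1 = (m * p1)\<^sup>2 + (4 - 6 * pi) * (m * p1) - 3 * pi * m"
    by (simp add: endpoint_quadratic_def m_def algebra_simps power2_eq_square)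
  also have "\<dots> = 4 * (r * r) + (3 * pi - 2)\<^sup>2 + (4 - 6 * pi) * (3 * pi - 2) - 3 * pi * m"
    unfolding p1 by (simp add: algebra_simps power2_eq_square)
  also have "\<dots> = 0" unfolding r m_def by (simp add: algebra_simps power2_eq_square)
  finally show ?thesis using m by simp
qed

text \<open>
  One root of the quadratic is \<open>p1\<close>; the product of the roots shows that the other one is
  negative. The factorization below is that of the quadratic, multiplied by \<open>p1\<close> to avoid a division.
\<close>
lemma endpoint_quadratic_nonpos:
  assumes "0 \<le> p" "p \<le> p1"
  shows "endpoint_quadratic p \<le> 0"
proof -
  have p1: "0 < p1" using p1_bounds by simp
  have "endpoint_quadratic p * p1
      = endpoint_quadratic p1 * p + (p - p1) * ((12 - 3 * pi) * (p * p1) + 3 * pi)"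
    by (simp add: endpoint_quadratic_def algebra_simps power2_eq_square)
  also have "\<dots> \<le> 0"
    using assms p1 pi_bounds unfolding endpoint_quadratic_p1
    by (auto intro!: mult_nonpos_nonneg add_nonneg_nonneg)
  finally show ?thesis using p1 by (simp add: mult_le_0_iff)
qed

lemma lower_bound_reversed:
  assumes p: "0 \<le> p" "p \<le> p1" and t: "0 < t" "t < pi / 2"
  shows "t < trig_bound p t"
proof -
  have "0 < (- 1) * (p\<^sup>2 - 6 * p - 3 - 2 * (p + 3) * cos s)" if "0 < s" "s < t" for s
  proof -
    have "0 < cos s" using cos_open_unit that t by auto
    then have "0 < 2 * (p + 3) * cos s" using p by (intro mult_pos_pos) auto
    moreover have "p * (p - 6.4) \<le> 0"
      using p p1_bounds by (intro mult_nonneg_nonpos) auto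
    moreover have "p \<le> 6.4" using p p1_bounds by auto
    ultimately show ?thesis by (simp add: power2_eq_square algebra_simps)
  qed
  from lower_comparison[OF _ t this] show ?thesis using p by auto
qed

text \<open>
  For positive \<open>p\<close> the upper comparison runs with \<open>\<sigma> = 1\<close>. At \<open>p = 0\<close>, where the denominator
  vanishes at \<open>t = \<pi>/2\<close>, the upper bound is identically zero.
\<close>
lemma upper_bound_reversed:
  assumes p: "0 \<le> p" "p \<le> p1" and t: "0 < t" "t < pi / 2"
  shows "upper_const p * trig_bound p t < t"
proof (cases "p = 0")
  case True
  then show ?thesis using t by (simp add: upper_const_def)
next
  case False
  have "(pi - 3) * p \<le> 0.1416 * p" using p pi_bounds by (intro mult_right_mono) auto
  then have "(pi - 3) * p < 1" using p p1_bounds by auto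
  then have K: "0 < 1 * (1 - upper_const p)"
    using p by (auto simp: upper_const_def divide_simps algebra_simps)
  have "0 < 1 * (t - upper_const p * trig_bound p t)"
    by (rule upper_comparison) (use p t K False endpoint_quadratic_nonpos in auto)
  then show ?thesis by simp
qed

section \<open>Optimality and monotonicity in the parameter\<close>

text \<open>
  As \<open>t \<rightarrow> \<pi>/2\<close> the assumed inequality passes to the limit \<open>\<pi>/2 \<le> c (3p + 1) / (2p)\<close>.
\<close>
lemma upper_const_optimal:
  assumes p: "p \<le> - 1 \<or> 0 < p" and bound: "\<And>t. 0 < t \<Longrightarrow> t < pi / 2 \<Longrightarrow> t < c * trig_bound p t"
  shows "upper_const p \<le> c"
proof -
  have "(trig_bound p \<longlongrightarrow> trig_bound p (pi / 2)) (at_left (pi / 2))"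
    using continuous_on_trig_bound[OF p]
    by (simp add: continuous_on_Icc_at_leftD)
  then have "((\<lambda>t. c * trig_bound p t) \<longlongrightarrow> c * trig_bound p (pi / 2)) (at_left (pi / 2))"
    by (intro tendsto_intros)
  moreover have "\<forall>\<^sub>F t in at_left (pi / 2). t \<le> c * trig_bound p t"
    unfolding eventually_at_left_field using bound by (intro exI[of _ 0]) (auto intro: less_imp_le)
  ultimately have "pi / 2 \<le> c * trig_bound p (pi / 2)"
    by (intro tendsto_le[OF _ _ tendsto_ident_at]) auto
  then show ?thesis
    using p by (auto simp: trig_bound_def upper_const_def divide_simps split: if_splits)
qed

lemma frac_less_same_sign:
  fixes a b c d :: real
  assumes "a * d < c * b" "0 < b * d"
  shows "a / b < c / d"
proof -
  have "b \<noteq> 0" "d \<noteq> 0" using assms by auto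
  then have "c / d - a / b = (c * b - a * d) / (b * d)" by (simp add: field_simps)
  also have "0 < \<dots>" using assms by simp
  finally show ?thesis by simp
qed

text \<open>
  As a function of \<open>p\<close> the quotient is a Moebius transformation with determinant
  \<open>-2 (1 - c)\<^sup>2 < 0\<close>, hence strictly decreasing where the denominator keeps its sign.
\<close>
lemma arcsin_lower_antimono:
  assumes x: "0 < x" "x < 1" and pq: "p < q" "q \<le> - 1 \<or> 0 < p"
  shows "arcsin_lower q x < arcsin_lower p x"
proof -
  define c where "c = sqrt (1 - x\<^sup>2)"
  have c: "0 < c" "c < 1" using x by (auto simp: c_def abs_square_less_1)
  let ?M = "\<lambda>p. 2 * p + (p + 3) * c"
  have MM: "0 < ?M q * ?M p"
    using pq c denominator_pos[of _ c] denominator_neg[of _ c]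
    by (cases "0 < p") (auto intro: mult_pos_pos mult_neg_neg)
  have "0 < 2 * (1 - c)\<^sup>2 * (q - p)" using c pq by simp
  also have "\<dots> = (3 * p + 1 + 2 * c) * ?M q - (3 * q + 1 + 2 * c) * ?M p"
    by (simp add: algebra_simps power2_eq_square)
  finally have "(3 * q + 1 + 2 * c) / ?M q < (3 * p + 1 + 2 * c) / ?M p"
    using MM by (intro frac_less_same_sign) auto
  then show ?thesis
    unfolding arcsin_lower_def c_def using x by (intro mult_strict_left_mono) auto
qed

text \<open>
  Cross-multiplying yields \<open>3c (q - p)\<close> times
  \<open>(5 - 2c) pq + 3 (p + q) + 1 + 2c = 3 (p + 1)(q + 1) + 2 (1 - c)(pq - 1)\<close>. The first form
  is clearly positive for positive parameters, the second one for parameters at most \<open>-1\<close>.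
\<close>
lemma arcsin_upper_mono:
  assumes x: "0 < x" "x < 1" and pq: "p < q" "q \<le> - 1 \<or> 0 < p"
  shows "arcsin_upper p x < arcsin_upper q x"
proof -
  define c where "c = sqrt (1 - x\<^sup>2)"
  have c: "0 < c" "c < 1" using x by (auto simp: c_def abs_square_less_1)
  let ?M = "\<lambda>p. 2 * p + (p + 3) * c"
  have MM: "0 < ((3 * p + 1) * ?M p) * ((3 * q + 1) * ?M q)"
  proof (cases "0 < p")
    case True
    then show ?thesis using pq c denominator_pos[of _ c] by (intro mult_pos_pos) auto
  next
    case False
    then show ?thesis using pq c denominator_neg[of _ c]
      by (intro mult_pos_pos mult_neg_neg) auto
  qed
  have "0 < (5 - 2 * c) * (p * q) + 3 * (p + q) + 1 + 2 * c"
  proof (cases "0 < p")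
    case True
    then show ?thesis using c pq by (intro add_pos_pos mult_pos_pos) auto
  next
    case False
    then have n: "p < - 1" "q \<le> - 1" using pq by auto
    have "0 \<le> (p + 1) * (q + 1)" using n by (intro mult_nonpos_nonpos) auto
    moreover have "0 < - p * (- q - 1) + (- p - 1)"
      using n by (intro add_nonneg_pos mult_nonneg_nonneg) auto
    then have "0 < p * q - 1" by (simp add: algebra_simps)
    then have "0 < 2 * (1 - c) * (p * q - 1)" using c by (intro mult_pos_pos) auto
    moreover have "(5 - 2 * c) * (p * q) + 3 * (p + q) + 1 + 2 * c
        = 3 * ((p + 1) * (q + 1)) + 2 * (1 - c) * (p * q - 1)"
      by (simp add: algebra_simps)
    ultimately show ?thesis by linarith
  qed
  then have "0 < (q - p) * (3 * c * ((5 - 2 * c) * (p * q) + 3 * (p + q) + 1 + 2 * c))"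
    using c pq by (intro mult_pos_pos) auto
  also have "\<dots> = q * (3 * q + 1 + 2 * c) * ((3 * p + 1) * ?M p)
      - p * (3 * p + 1 + 2 * c) * ((3 * q + 1) * ?M q)"
    by (simp add: algebra_simps power2_eq_square)
  finally have "p * (3 * p + 1 + 2 * c) / ((3 * p + 1) * ?M p)
      < q * (3 * q + 1 + 2 * c) / ((3 * q + 1) * ?M q)"
    using MM by (intro frac_less_same_sign) auto
  then have "pi * x * (p * (3 * p + 1 + 2 * c) / ((3 * p + 1) * ?M p))
      < pi * x * (q * (3 * q + 1 + 2 * c) / ((3 * q + 1) * ?M q))"
    using x by (intro mult_strict_left_mono) auto
  then show ?thesis by (simp add: arcsin_upper_def upper_const_def arcsin_lower_def c_def mult_ac)
qed

theorem proposition1: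
  shows
    "(\<forall>p::real. p \<in> {..-1} \<union> {0..} \<longrightarrow>
        ((\<forall>x\<in>{0<..<1}. arcsin_lower p x < arcsin x \<and> arcsin x < arcsin_upper p x)
          \<longleftrightarrow> p \<in> {..-1} \<union> {9..}))
   \<and> (\<forall>p::real. p \<in> {..-1} \<union> {9..} \<longrightarrow>
        (\<forall>c::real. c < upper_const p \<longrightarrow>
          \<not> (\<forall>x\<in>{0<..<1}. arcsin x < c * arcsin_lower p x)))
   \<and> (\<forall>x::real. x \<in> {0<..<1} \<longrightarrow>
        strict_antimono_on {..-1} (\<lambda>p. arcsin_lower p x)
      \<and> strict_antimono_on {0<..} (\<lambda>p. arcsin_lower p x)
      \<and> strict_mono_on {..-1} (\<lambda>p. arcsin_upper p x)
      \<and> strict_mono_on {0<..} (\<lambda>p. arcsin_upper p x))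
   \<and> (\<forall>p::real. p \<in> {0..p1} \<longrightarrow>
        (\<forall>x\<in>{0<..<1}. arcsin_lower p x > arcsin x \<and> arcsin x > arcsin_upper p x))
   \<and> \<bar>p1 - 6.343\<bar> < 0.0005"
proof (intro conjI allI impI)
  fix p :: real assume p: "p \<in> {..-1} \<union> {0..}"
  show "(\<forall>x\<in>{0<..<1}. arcsin_lower p x < arcsin x \<and> arcsin x < arcsin_upper p x)
          \<longleftrightarrow> p \<in> {..-1} \<union> {9..}" (is "?L \<longleftrightarrow> ?R")
  proof -
    have "?L \<longleftrightarrow> (\<forall>t\<in>{0<..<pi / 2}. trig_bound p t < t \<and> t < upper_const p * trig_bound p t)"
      unfolding arcsin_upper_def
      by (rule ball_arcsin_iff[where R = "\<lambda>l a. l < a \<and> a < upper_const p * l"])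
    also have "\<dots> \<longleftrightarrow> ?R"
    proof
      assume *: "\<forall>t\<in>{0<..<pi / 2}. trig_bound p t < t \<and> t < upper_const p * trig_bound p t"
      show ?R
      proof (rule ccontr)
        assume "\<not> ?R"
        then have "0 \<le> p" "p < 9" using p by auto
        then obtain t where "0 < t" "t < pi / 2" "t < trig_bound p t"
          by (rule lower_bound_fails)
        then show False using * by (meson greaterThanLessThan_iff less_asym)
      qed
    qed (use lower_bound upper_bound in auto)
    finally show ?thesis .
  qed
next
  fix p c :: real assume p: "p \<in> {..-1} \<union> {9..}" and c: "c < upper_const p"
  show "\<not> (\<forall>x\<in>{0<..<1}. arcsin x < c * arcsin_lower p x)"
    unfolding ball_arcsin_iff[where R = "\<lambda>l a. a < c * l"]
    using upper_const_optimal[of p c] p c by (force simp: not_less)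
next
  fix x :: real assume x: "x \<in> {0<..<1}"
  show "strict_antimono_on {..-1} (\<lambda>p. arcsin_lower p x)"
    "strict_antimono_on {0<..} (\<lambda>p. arcsin_lower p x)"
    "strict_mono_on {..-1} (\<lambda>p. arcsin_upper p x)"
    "strict_mono_on {0<..} (\<lambda>p. arcsin_upper p x)"
    using x by (auto intro!: monotone_onI arcsin_lower_antimono arcsin_upper_mono)
next
  fix p :: real assume p: "p \<in> {0..p1}"
  show "\<forall>x\<in>{0<..<1}. arcsin_lower p x > arcsin x \<and> arcsin x > arcsin_upper p x"
    unfolding arcsin_upper_def ball_arcsin_iff[where R = "\<lambda>l a. l > a \<and> a > upper_const p * l"]
    using p lower_bound_reversed upper_bound_reversed by auto
next
  show "\<bar>p1 - 6.343\<bar> < 0.0005"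
    unfolding abs_less_iff using p1_bounds by simp
qed

end
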